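(* For every $n\ge 1$, the complete graph $K_n$ is a minimal element in the poset $\mathcal{E}_n$.
   Context: All graphs are finite and simple. The chromatic symmetric function of a graph $G$ with vertices $v_1,\dots,v_n$ is $X_G=\sum_{\kappa}x_{\kappa(v_1)}\cdots x_{\kappa(v_n)}$, summed over all proper colorings $\kappa:V(G)\to\{1,2,3,\dots\}$; it is a homogeneous symmetric function of degree $n$ over $\mathbb{Q}$. Let $e_\lambda=e_{\lambda_1}e_{\lambda_2}\cdots$ be the elementary symmetric functions; $[e_\lambda]F$ denotes the coefficient of $e_\lambda$ in $F$ expanded in this basis, and $F$ is $e$-positive if $[e_\lambda]F\ge 0$ for all $\lambda$. For connected graphs $G,H$ on $n$ vertices (for which $[e_{(n)}]X_G$ and $[e_{(n)}]X_H$ are positive), set $$X_e(G,H)=X_G-\frac{[e_{(n)}]X_G}{[e_{(n)}]X_H}X_H.$$ $\mathcal{E}_n$ is the poset whose elements are the equivalence classes of connected graphs on $n$ vertices under $G\sim H\iff X_G=X_H$, ordered by $G\geq_e H$ if and only if $X_e(G,H)$ is $e$-positive. An element $x$ of a poset is minimal if $y\geq x$ for every $y$ comparable to $x$. *)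

theory Defs
  imports "HOL-Library.Multiset" "HOL-Library.FuncSet"
    "Graph_Theory.Graph_Theory"
begin

section \<open>Power series in countably many variables\<close>

text \<open>
  A monomial in the variables \<open>x\<^sub>1, x\<^sub>2, \<dots>\<close> is encoded by the multiset of the indices of its
  variables, so that the product of monomials is the sum of multisets. A power series over the
  rationals is given by its coefficients; the index 0 never occurs in the series defined below.
\<close>

typedef pseries = "UNIV :: (nat multiset \<Rightarrow> rat) set"
  morphisms mcoeff Abs_pseries ..

declare mcoeff_inverse [simp] Abs_pseries_inverse [OF UNIV_I, simp]

lemma pseries_eqI: "(\<And>M. mcoeff F M = mcoeff G M) \<Longrightarrow> F = G"
  by (metis ext mcoeff_inject)

lemma finite_mset_splits: "finite {(A, B). A + B = (M :: nat multiset)}"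
proof (rule finite_subset)
  have fin: "finite {A. A \<subseteq># M}"
  proof (rule finite_subset)
    show "{A. A \<subseteq># M} \<subseteq> mset ` {xs. set xs \<subseteq> set_mset M \<and> length xs \<le> size M}"
    proof
      fix A assume "A \<in> {A. A \<subseteq># M}"
      then have "A \<subseteq># M" by simp
      moreover obtain xs where "A = mset xs" by (metis ex_mset)
      ultimately show "A \<in> mset ` {xs. set xs \<subseteq> set_mset M \<and> length xs \<le> size M}"
        using set_mset_mono[of A M] size_mset_mono[of A M] by auto
    qed
    show "finite (mset ` {xs. set xs \<subseteq> set_mset M \<and> length xs \<le> size M})"
      by (intro finite_imageI finite_lists_length_le) simp
  qed
  show "{(A, B). A + B = M} \<subseteq> {A. A \<subseteq># M} \<times> {A. A \<subseteq># M}" by auto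
  show "finite ({A. A \<subseteq># M} \<times> {A. A \<subseteq># M})" using fin by simp
qed

instantiation pseries :: comm_ring_1
begin

definition zero_pseries :: pseries where
  "0 = Abs_pseries (\<lambda>M. 0)"
definition one_pseries :: pseries where
  "1 = Abs_pseries (\<lambda>M. if M = {#} then 1 else 0)"
definition plus_pseries :: "pseries \<Rightarrow> pseries \<Rightarrow> pseries" where
  "F + G = Abs_pseries (\<lambda>M. mcoeff F M + mcoeff G M)"
definition minus_pseries :: "pseries \<Rightarrow> pseries \<Rightarrow> pseries" where
  "F - G = Abs_pseries (\<lambda>M. mcoeff F M - mcoeff G M)"
definition uminus_pseries :: "pseries \<Rightarrow> pseries" where
  "- F = Abs_pseries (\<lambda>M. - mcoeff F M)"
definition times_pseries :: "pseries \<Rightarrow> pseries \<Rightarrow> pseries" where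
  "F * G = Abs_pseries (\<lambda>M. \<Sum>(A, B) | A + B = M. mcoeff F A * mcoeff G B)"

lemma mcoeff_simps [simp]:
  "mcoeff 0 M = 0"
  "mcoeff 1 M = (if M = {#} then 1 else 0)"
  "mcoeff (F + G) M = mcoeff F M + mcoeff G M"
  "mcoeff (F - G) M = mcoeff F M - mcoeff G M"
  "mcoeff (- F) M = - mcoeff F M"
  by (simp_all add: zero_pseries_def one_pseries_def plus_pseries_def minus_pseries_def
      uminus_pseries_def)

lemma mcoeff_times:
  "mcoeff (F * G) M = (\<Sum>(A, B) | A + B = M. mcoeff F A * mcoeff G B)"
  by (simp add: times_pseries_def)

instance
proof
  fix F G H :: pseries
  show "F * G * H = F * (G * H)"
  proof (rule pseries_eqI)
    fix M
    have fin: "\<And>N. finite {p. case p of (A, B) \<Rightarrow> A + B = (N :: nat multiset)}"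
      using finite_mset_splits by simp
    have "mcoeff (F * G * H) M =
        (\<Sum>p | fst p + snd p = M. \<Sum>q | fst q + snd q = fst p.
           mcoeff F (fst q) * mcoeff G (snd q) * mcoeff H (snd p))"
      by (simp add: mcoeff_times case_prod_unfold sum_distrib_right)
    also have "\<dots> = (\<Sum>(p, q) \<in> Sigma {p. fst p + snd p = M} (\<lambda>p. {q. fst q + snd q = fst p}).
           mcoeff F (fst q) * mcoeff G (snd q) * mcoeff H (snd p))"
      using fin by (subst sum.Sigma) (auto simp: case_prod_unfold)
    also have "\<dots> = (\<Sum>(p, q) \<in> Sigma {p. fst p + snd p = M} (\<lambda>p. {q. fst q + snd q = snd p}).
           mcoeff F (fst p) * (mcoeff G (fst q) * mcoeff H (snd q)))"
      by (rule sum.reindex_bij_witness[where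
            i = "\<lambda>(p, q). ((fst p + fst q, snd q), (fst p, fst q))" and
            j = "\<lambda>(p, q). ((fst q, snd q + snd p), (snd q, snd p))"])
         (auto simp: add.assoc mult.assoc)
    also have "\<dots> = (\<Sum>p | fst p + snd p = M. \<Sum>q | fst q + snd q = snd p.
           mcoeff F (fst p) * (mcoeff G (fst q) * mcoeff H (snd q)))"
      using fin by (subst sum.Sigma) (auto simp: case_prod_unfold)
    also have "\<dots> = mcoeff (F * (G * H)) M"
      by (simp add: mcoeff_times case_prod_unfold sum_distrib_left)
    finally show "mcoeff (F * G * H) M = mcoeff (F * (G * H)) M" .
  qed
  show "F * G = G * F"
    by (rule pseries_eqI, unfold mcoeff_times)
       (rule sum.reindex_bij_witness[where i = prod.swap and j = prod.swap],
         auto simp: add.commute mult.commute)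
  show "1 * F = F"
  proof (rule pseries_eqI)
    fix M
    have "mcoeff (1 * F) M = (\<Sum>(A, B) \<in> {({#}, M)}. mcoeff 1 A * mcoeff F B)"
      unfolding mcoeff_times
      by (rule sum.mono_neutral_right) (use finite_mset_splits in \<open>auto split: if_splits\<close>)
    then show "mcoeff (1 * F) M = mcoeff F M" by simp
  qed
  show "(F + G) * H = F * H + G * H"
    by (rule pseries_eqI)
       (simp add: mcoeff_times case_prod_unfold distrib_right sum.distrib)
  have "mcoeff 0 {#} \<noteq> mcoeff 1 {#}" by simp
  then show "(0 :: pseries) \<noteq> 1" by metis
qed (auto intro!: pseries_eqI)

end

definition smult_pseries :: "rat \<Rightarrow> pseries \<Rightarrow> pseries" (infixr \<open>*\<^sub>s\<close> 75) where
  "c *\<^sub>s F = Abs_pseries (\<lambda>M. c * mcoeff F M)"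


section \<open>Elementary symmetric functions\<close>

text \<open>Partitions are encoded as multisets of positive integers.\<close>

definition is_partition :: "nat multiset \<Rightarrow> bool" where
  "is_partition \<mu> \<longleftrightarrow> 0 \<notin># \<mu>"

definition elem_sym :: "nat \<Rightarrow> pseries" where
  "elem_sym k = Abs_pseries
     (\<lambda>M. if \<exists>S. finite S \<and> S \<subseteq> {1..} \<and> card S = k \<and> M = mset_set S then 1 else 0)"

definition elem_sym_part :: "nat multiset \<Rightarrow> pseries" where
  "elem_sym_part \<mu> = (\<Prod>k \<in># \<mu>. elem_sym k)"

definition is_e_expansion :: "pseries \<Rightarrow> (nat multiset \<Rightarrow> rat) \<Rightarrow> bool" where
  "is_e_expansion F c \<longleftrightarrow>
     finite {\<mu>. c \<mu> \<noteq> 0} \<and> (\<forall>\<mu>. c \<mu> \<noteq> 0 \<longrightarrow> is_partition \<mu>) \<and>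
     F = (\<Sum>\<mu> | c \<mu> \<noteq> 0. c \<mu> *\<^sub>s elem_sym_part \<mu>)"

text \<open>
  Since the \<open>e\<^sub>\<mu>\<close> form a basis of the space of symmetric functions, the description is
  proper for every symmetric function \<open>F\<close>. It is not meaningful for other power series.
\<close>

definition e_coeff :: "nat multiset \<Rightarrow> pseries \<Rightarrow> rat" where
  "e_coeff \<mu> F = (THE c. is_e_expansion F c) \<mu>"

definition e_positive :: "pseries \<Rightarrow> bool" where
  "e_positive F \<longleftrightarrow> (\<forall>\<mu>. is_partition \<mu> \<longrightarrow> e_coeff \<mu> F \<ge> 0)"


section \<open>Chromatic symmetric functions\<close>

text \<open>
  Finite simple graphs are the finite, symmetric, loopfree digraphs without parallel arcs, i.e.
  \<^const>\<open>pair_graph\<close>: every edge is represented by its two arcs.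
\<close>

definition proper_colorings :: "'a pair_pre_digraph \<Rightarrow> ('a \<Rightarrow> nat) set" where
  "proper_colorings G =
     {\<kappa> \<in> pverts G \<rightarrow>\<^sub>E {1..}. \<forall>(u, v) \<in> parcs G. \<kappa> u \<noteq> \<kappa> v}"

text \<open>
  The coefficient of a monomial counts the proper colorings that contribute it; there are only
  finitely many, as their values lie in the given multiset.
\<close>

definition chromatic_sym :: "'a pair_pre_digraph \<Rightarrow> pseries" where
  "chromatic_sym G = Abs_pseries
     (\<lambda>M. of_nat (card {\<kappa> \<in> proper_colorings G. image_mset \<kappa> (mset_set (pverts G)) = M}))"

definition X_e :: "nat \<Rightarrow> 'a pair_pre_digraph \<Rightarrow> 'b pair_pre_digraph \<Rightarrow> pseries" where
  "X_e n G H = chromatic_sym G -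
     (e_coeff {#n#} (chromatic_sym G) / e_coeff {#n#} (chromatic_sym H)) *\<^sub>s chromatic_sym H"


section \<open>The poset of connected graphs on \<open>n\<close> vertices\<close>

text \<open>
  Vertices are natural numbers, but the vertex set is an arbitrary set of \<open>n\<close> of them; up to
  isomorphism, this covers all finite graphs.
\<close>

definition connected_graphs :: "nat \<Rightarrow> nat pair_pre_digraph set" where
  "connected_graphs n =
     {G. pair_graph G \<and> card (pverts G) = n \<and> Digraph_Component.connected (with_proj G)}"

definition csf_rel :: "nat \<Rightarrow> nat pair_pre_digraph rel" where
  "csf_rel n = {(G, H). G \<in> connected_graphs n \<and> H \<in> connected_graphs n \<and>
     chromatic_sym G = chromatic_sym H}"

definition E_poset :: "nat \<Rightarrow> nat pair_pre_digraph set set" where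
  "E_poset n = connected_graphs n // csf_rel n"

text \<open>Independent of the representatives, as \<^const>\<open>X_e\<close> depends only on the chromatic
  symmetric functions.\<close>

definition e_geq :: "nat \<Rightarrow> nat pair_pre_digraph set \<Rightarrow> nat pair_pre_digraph set \<Rightarrow> bool" where
  "e_geq n A B \<longleftrightarrow> (\<exists>G \<in> A. \<exists>H \<in> B. e_positive (X_e n G H))"

definition minimal_element :: "'a set \<Rightarrow> ('a \<Rightarrow> 'a \<Rightarrow> bool) \<Rightarrow> 'a \<Rightarrow> bool" where
  "minimal_element P geq x \<longleftrightarrow>
     x \<in> P \<and> (\<forall>y \<in> P. geq x y \<or> geq y x \<longrightarrow> geq y x)"

end

theory Submission
  imports Defs "HOL-Computational_Algebra.Polynomial"
begin

text \<open>
  As \<open>X\<^bsub>K\<^sub>n\<^esub> = n! e\<^sub>n\<close>, if \<open>X\<^sub>e(K\<^sub>n, H)\<close> is \<open>e\<close>-positive and \<open>[e\<^sub>n] X\<^sub>H > 0\<close>, then all coefficients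
  of \<open>X\<^sub>H\<close> other than that of \<open>e\<^sub>n\<close> are nonpositive. For each \<open>\<mu> \<noteq> (n)\<close>, some monomial of \<open>e\<^sub>\<mu>\<close> is not
  squarefree and hence does not occur in \<open>e\<^sub>n\<close>; since the monomial coefficients of \<open>X\<^sub>H\<close> are
  nonnegative, \<open>[e\<^sub>\<mu>] X\<^sub>H\<close> must vanish. Thus \<open>X\<^sub>H\<close> is a multiple of \<open>e\<^sub>n\<close>, and \<open>X\<^sub>e(H, K\<^sub>n) = 0\<close>.
  If \<open>[e\<^sub>n] X\<^sub>H\<close> were negative, the other coefficients would be nonnegative at once, so that only
  \<open>[e\<^sub>n] X\<^sub>H \<noteq> 0\<close> is needed.

  That \<open>[e\<^sub>n] X\<^sub>H \<noteq> 0\<close> for connected \<open>H\<close> is seen by setting \<open>N\<close> variables to 1 and the others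
  to 0: \<open>e\<^sub>\<mu>\<close> becomes \<open>\<Prod>\<^sub>i (N choose \<mu>\<^sub>i)\<close>, which is divisible by \<open>N\<^sup>2\<close> unless \<open>\<mu> = (n)\<close>, while
  \<open>X\<^sub>H\<close> becomes the chromatic polynomial, whose linear coefficient is nonzero by
  deletion-contraction.

  Existence and uniqueness of \<open>e\<close>-expansions come from grading monomials by the sum of their
  indices: the minimal monomial of \<open>e\<^sub>\<mu>\<close> is the product of the \<open>x\<^sub>1 \<cdots> x\<^sub>k\<close> over the parts \<open>k\<close>
  of \<open>\<mu>\<close>, and in it the exponents are weakly decreasing, like in every minimal monomial of a
  symmetric series.
\<close>

section \<open>Expansions in the elementary symmetric functions\<close>

lemma mcoeff_smult [simp]: "mcoeff (c *\<^sub>s F) M = c * mcoeff F M"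
  by (simp add: smult_pseries_def)

lemma mcoeff_sum: "mcoeff (\<Sum>x\<in>A. f x) M = (\<Sum>x\<in>A. mcoeff (f x) M)"
  by (induction A rule: infinite_finite_induct) auto

lemma elem_sym_part_empty [simp]: "elem_sym_part {#} = 1"
  by (simp add: elem_sym_part_def)

lemma elem_sym_part_add: "elem_sym_part (add_mset k \<mu>) = elem_sym k * elem_sym_part \<mu>"
  by (simp add: elem_sym_part_def)

lemma mcoeff_times_ne0D:
  assumes "mcoeff (F * G) M \<noteq> 0"
  obtains A B where "M = A + B" "mcoeff F A \<noteq> 0" "mcoeff G B \<noteq> 0"
proof -
  have "\<exists>p \<in> {(A, B). A + B = M}. (case p of (A, B) \<Rightarrow> mcoeff F A * mcoeff G B) \<noteq> 0"
    using assms sum.not_neutral_contains_not_neutral[of "\<lambda>(A, B). mcoeff F A * mcoeff G B"]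
    unfolding mcoeff_times by metis
  then show ?thesis using that by auto
qed

lemma mcoeff_elem_sym_ne0D:
  assumes "mcoeff (elem_sym k) M \<noteq> 0"
  obtains S where "finite S" "S \<subseteq> {1..}" "card S = k" "M = mset_set S"
  using assms by (auto simp: elem_sym_def split: if_splits)

lemma mcoeff_elem_sym_part_nonneg: "mcoeff (elem_sym_part \<mu>) M \<ge> 0"
proof (induction \<mu> arbitrary: M)
  case (add k \<mu>)
  have "mcoeff (elem_sym k) A \<ge> 0" for A by (simp add: elem_sym_def)
  with add show ?case
    by (auto simp: elem_sym_part_add mcoeff_times intro!: sum_nonneg mult_nonneg_nonneg)
qed auto

section \<open>Leading monomials of products of elementary symmetric functions\<close>

definition lead_monom :: "nat multiset \<Rightarrow> nat multiset" where
  "lead_monom \<mu> = (\<Sum>k\<in>#\<mu>. mset_set {1..k})"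

lemma lead_monom_simps [simp]:
  "lead_monom {#} = {#}"
  "lead_monom (add_mset k \<mu>) = mset_set {1..k} + lead_monom \<mu>"
  by (simp_all add: lead_monom_def)

text \<open>Induction on the size, removing the maximum: among \<open>k + 1\<close> distinct
  positive integers the largest is at least \<open>k + 1\<close>, with equality only for the
  interval.\<close>

lemma sum_interval_le_sum:
  fixes S :: "nat set"
  assumes "finite S" "S \<subseteq> {1..}"
  shows "\<Sum>{1..card S} \<le> \<Sum>S \<and> (\<Sum>{1..card S} = \<Sum>S \<longrightarrow> S = {1..card S})"
  using assms
proof (induction "card S" arbitrary: S)
  case 0
  then show ?case by simp
next
  case (Suc k)
  let ?m = "Max S" and ?T = "S - {Max S}"
  have S: "?m \<in> S" using Suc by (intro Max_in) auto
  have T: "card ?T = k" "finite ?T" "?T \<subseteq> {1..}" using Suc S by auto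
  have "S \<subseteq> {1..?m}" using Suc.prems by auto
  then have m: "Suc k \<le> ?m" "S = {1..?m}" if "?m \<le> Suc k"
    using card_mono[of "{1..?m}" S] Suc.hyps(2) card_subset_eq[of "{1..?m}" S] that by auto
  then have m': "Suc k \<le> ?m" by linarith
  have sum: "\<Sum>S = ?m + \<Sum>?T" using S Suc.prems by (simp add: sum.remove)
  have IH: "\<Sum>{1..k} \<le> \<Sum>?T" using Suc.hyps(1)[of ?T] T by simp
  show ?case
  proof
    show "\<Sum>{1..card S} \<le> \<Sum>S" using sum IH m' Suc.hyps(2)[symmetric] by simp
    show "\<Sum>{1..card S} = \<Sum>S \<longrightarrow> S = {1..card S}"
    proof
      assume "\<Sum>{1..card S} = \<Sum>S"
      then have "?m \<le> Suc k" using sum IH Suc.hyps(2)[symmetric] by simp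
      then show "S = {1..card S}" using m m' Suc.hyps(2) by (metis le_antisym)
    qed
  qed
qed

text \<open>Each factor \<open>elem_sym k\<close> contributes \<open>k\<close> distinct positive
  indices, whose sum is least for \<open>{1..k}\<close>; a minimal total forces minimality in every
  factor.\<close>

lemma mcoeff_elem_sym_part_ne0D:
  assumes "mcoeff (elem_sym_part \<mu>) M \<noteq> 0"
  shows "size M = \<Sum>\<^sub># \<mu> \<and> 0 \<notin># M \<and> \<Sum>\<^sub># (lead_monom \<mu>) \<le> \<Sum>\<^sub># M
    \<and> (\<Sum>\<^sub># (lead_monom \<mu>) = \<Sum>\<^sub># M \<longrightarrow> M = lead_monom \<mu>)"
  using assms
proof (induction \<mu> arbitrary: M)
  case empty
  then show ?case by (auto split: if_splits)
next
  case (add k \<mu>)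
  from add.prems obtain A B where M: "M = A + B" "mcoeff (elem_sym k) A \<noteq> 0"
      "mcoeff (elem_sym_part \<mu>) B \<noteq> 0"
    by (auto simp: elem_sym_part_add elim: mcoeff_times_ne0D)
  from M(2) obtain S where S: "finite S" "S \<subseteq> {1..}" "card S = k" "A = mset_set S"
    by (rule mcoeff_elem_sym_ne0D)
  have sm: "\<Sum>\<^sub># (mset_set T) = \<Sum>T" for T :: "nat set" by (simp add: sum_unfold_sum_mset)
  have "0 \<notin># A" using S by auto
  then show ?case
    using add.IH[OF M(3)] sum_interval_le_sum[OF S(1,2)] S(3,4) M(1) by (auto simp: sm)
qed

lemma mcoeff_lead_monom_pos: "mcoeff (elem_sym_part \<mu>) (lead_monom \<mu>) > 0"
proof (induction \<mu>)
  case (add k \<mu>)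
  let ?L = "lead_monom (add_mset k \<mu>)" and ?f = "\<lambda>(A, B). mcoeff (elem_sym k) A * mcoeff (elem_sym_part \<mu>) B"
  let ?p = "(mset_set {1..k}, lead_monom \<mu>)"
  have "mcoeff (elem_sym k) (mset_set {1..k}) = 1"
    unfolding elem_sym_def by (auto intro!: exI[of _ "{1..k}"])
  then have "0 < ?f ?p" using add by simp
  also have "?f ?p \<le> sum ?f {(A, B). A + B = ?L}"
    by (rule member_le_sum)
      (auto simp: elem_sym_def mcoeff_elem_sym_part_nonneg finite_mset_splits)
  finally show ?case by (simp add: elem_sym_part_add mcoeff_times)
qed auto

text \<open>The exponents of the leading monomial form the conjugate partition of
  \<open>\<mu>\<close>.\<close>

lemma count_lead_monom: "count (lead_monom \<mu>) j = (if j = 0 then 0 else size {#k \<in># \<mu>. j \<le> k#})"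
  by (induction \<mu>) (auto simp: count_mset_set')

text \<open>The multiplicity of a part \<open>j\<close> is the drop between the exponents at
  \<open>j\<close> and \<open>Suc j\<close>. Parts 0 leave no trace in the monomial, hence the
  restriction to partitions.\<close>

lemma lead_monom_inj:
  assumes "is_partition \<mu>" "is_partition \<nu>" "lead_monom \<mu> = lead_monom \<nu>"
  shows "\<mu> = \<nu>"
proof (rule multiset_eqI)
  fix j
  have *: "size {#k \<in># \<mu>. i \<le> k#} = size {#k \<in># \<nu>. i \<le> k#}" if "i > 0" for i
    using that assms(3) by (metis count_lead_monom less_not_refl)
  have c: "size {#k \<in># \<kappa>. i \<le> k#} = count \<kappa> i + size {#k \<in># \<kappa>. Suc i \<le> k#}" for \<kappa> :: "nat multiset" and i
    by (induction \<kappa>) auto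
  show "count \<mu> j = count \<nu> j"
  proof (cases "j = 0")
    case True
    then show ?thesis using assms by (simp add: is_partition_def not_in_iff)
  next
    case False
    then show ?thesis using *[of j] *[of "Suc j"] c[of j \<mu>] c[of j \<nu>] by simp
  qed
qed

section \<open>Uniqueness of expansions\<close>

lemma is_e_expansion_iff:
  "is_e_expansion F c \<longleftrightarrow> finite {\<mu>. c \<mu> \<noteq> 0} \<and> (\<forall>\<mu>. c \<mu> \<noteq> 0 \<longrightarrow> is_partition \<mu>) \<and>
     (\<forall>M. mcoeff F M = (\<Sum>\<mu> | c \<mu> \<noteq> 0. c \<mu> * mcoeff (elem_sym_part \<mu>) M))"
  unfolding is_e_expansion_def by (auto simp: mcoeff_sum intro!: pseries_eqI)

lemma e_expansion_lincomb:
  assumes "is_e_expansion F c" "is_e_expansion G d"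
  shows "is_e_expansion (F - r *\<^sub>s G) (\<lambda>\<mu>. c \<mu> - r * d \<mu>)"
proof -
  let ?A = "{\<mu>. c \<mu> \<noteq> 0} \<union> {\<mu>. d \<mu> \<noteq> 0}"
  have A: "finite ?A" using assms by (auto simp: is_e_expansion_iff)
  have sub: "{\<mu>. c \<mu> - r * d \<mu> \<noteq> 0} \<subseteq> ?A" by auto
  \<comment> \<open>Cancellation makes the supports differ, so all sums are compared over the common
    finite set \<open>?A\<close>.\<close>
  have ext: "(\<Sum>\<mu> | f \<mu> \<noteq> 0. f \<mu> * g \<mu>) = (\<Sum>\<mu>\<in>?A. f \<mu> * g \<mu>)"
    if "{\<mu>. f \<mu> \<noteq> 0} \<subseteq> ?A" for f g :: "nat multiset \<Rightarrow> rat"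
    using A that by (intro sum.mono_neutral_left) auto
  have "mcoeff (F - r *\<^sub>s G) M =
     (\<Sum>\<mu> | c \<mu> - r * d \<mu> \<noteq> 0. (c \<mu> - r * d \<mu>) * mcoeff (elem_sym_part \<mu>) M)" for M
    using assms unfolding is_e_expansion_iff
    by (subst ext[OF sub])
       (simp add: ext algebra_simps sum_subtractf sum_distrib_left)
  moreover have "is_partition \<mu>" if "c \<mu> - r * d \<mu> \<noteq> 0" for \<mu>
    using assms that unfolding is_e_expansion_iff by (metis diff_zero mult_zero_right)
  ultimately show ?thesis
    using finite_subset[OF sub A] unfolding is_e_expansion_iff by blast
qed

text \<open>Triangularity: among the partitions with nonzero coefficient, one whose leading monomial
  has least index sum is chosen; no other term reaches that monomial.\<close>

lemma e_expansion_zero: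
  assumes "is_e_expansion 0 c"
  shows "c \<mu> = 0"
proof (rule ccontr)
  assume "c \<mu> \<noteq> 0"
  then obtain \<nu> where \<nu>: "c \<nu> \<noteq> 0"
    and min: "\<And>\<kappa>. c \<kappa> \<noteq> 0 \<Longrightarrow> \<Sum>\<^sub># (lead_monom \<nu>) \<le> \<Sum>\<^sub># (lead_monom \<kappa>)"
    using ex_has_least_nat[of "\<lambda>\<nu>. c \<nu> \<noteq> 0" \<mu> "\<lambda>\<nu>. \<Sum>\<^sub># (lead_monom \<nu>)"] by blast
  have z: "mcoeff (elem_sym_part \<kappa>) (lead_monom \<nu>) = 0" if "c \<kappa> \<noteq> 0" "\<kappa> \<noteq> \<nu>" for \<kappa>
  proof (rule ccontr)
    assume "mcoeff (elem_sym_part \<kappa>) (lead_monom \<nu>) \<noteq> 0"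
    then have "lead_monom \<nu> = lead_monom \<kappa>"
      using mcoeff_elem_sym_part_ne0D min[OF that(1)] le_antisym by blast
    then show False using lead_monom_inj that \<nu> assms by (auto simp: is_e_expansion_iff)
  qed
  have "0 = (\<Sum>\<kappa> | c \<kappa> \<noteq> 0. c \<kappa> * mcoeff (elem_sym_part \<kappa>) (lead_monom \<nu>))"
    using assms by (simp add: is_e_expansion_iff)
  also have "\<dots> = (\<Sum>\<kappa>\<in>{\<nu>}. c \<kappa> * mcoeff (elem_sym_part \<kappa>) (lead_monom \<nu>))"
    using assms \<nu> z by (intro sum.mono_neutral_right) (auto simp: is_e_expansion_iff)
  finally show False using \<nu> mcoeff_lead_monom_pos[of \<nu>] by simp
qed

lemma e_expansion_unique:
  assumes "is_e_expansion F c" "is_e_expansion F d"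
  shows "c = d"
proof
  fix \<mu>
  have "F - 1 *\<^sub>s F = 0" by (rule pseries_eqI) simp
  then show "c \<mu> = d \<mu>"
    using e_expansion_zero e_expansion_lincomb[OF assms, of 1] by fastforce
qed

lemma e_coeff_eqI: "is_e_expansion F c \<Longrightarrow> e_coeff \<mu> F = c \<mu>"
  unfolding e_coeff_def by (metis e_expansion_unique theI')

section \<open>Existence of expansions of homogeneous symmetric series\<close>

text \<open>Adjacent transpositions suffice, as they generate the finitary permutations of the variables.\<close>

definition symmetric_series :: "pseries \<Rightarrow> bool" where
  "symmetric_series F \<longleftrightarrow>
     (\<forall>M i. i \<ge> 1 \<longrightarrow> mcoeff F (image_mset (transpose i (Suc i)) M) = mcoeff F M)"

definition homogeneous_series :: "nat \<Rightarrow> pseries \<Rightarrow> bool" where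
  "homogeneous_series n F \<longleftrightarrow> (\<forall>M. mcoeff F M \<noteq> 0 \<longrightarrow> size M = n \<and> 0 \<notin># M)"

definition dominant :: "nat multiset \<Rightarrow> bool" where
  "dominant M \<longleftrightarrow> 0 \<notin># M \<and> (\<forall>i\<ge>1. count M (Suc i) \<le> count M i)"

lemma transpose_image_mset_twice:
  "image_mset (transpose i j) (image_mset (transpose i j) M) = M"
  by (simp add: multiset.map_comp)

lemma symmetric_series_times:
  assumes "symmetric_series F" "symmetric_series G"
  shows "symmetric_series (F * G)"
  unfolding symmetric_series_def
proof (intro allI impI)
  fix M and i :: nat assume i: "i \<ge> 1"
  let ?t = "image_mset (transpose i (Suc i))"
  show "mcoeff (F * G) (?t M) = mcoeff (F * G) M"
    unfolding mcoeff_times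
    by (rule sum.reindex_bij_witness[where i = "map_prod ?t ?t" and j = "map_prod ?t ?t"])
      (use assms i in \<open>auto simp: transpose_image_mset_twice symmetric_series_def
        simp flip: image_mset_union\<close>)
qed

lemma symmetric_elem_sym: "symmetric_series (elem_sym k)"
proof -
  let ?P = "\<lambda>M. \<exists>S. finite S \<and> S \<subseteq> {1..} \<and> card S = k \<and> M = mset_set S"
  have *: "?P (image_mset (transpose i (Suc i)) M)" if P: "?P M" and i: "i \<ge> 1" for M and i :: nat
  proof -
    obtain S where S: "finite S" "S \<subseteq> {1..}" "card S = k" "M = mset_set S" using P by blast
    let ?t = "transpose i (Suc i)"
    have "?t ` S \<subseteq> {1..}" using S(2) i by (auto simp: transpose_def)
    then show ?thesis
      using S by (intro exI[of _ "?t ` S"]) (auto simp: card_image image_mset_mset_set)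
  qed
  \<comment> \<open>The transposition is an involution, so the implication applied to
    \<open>M\<close> and to its image gives both directions.\<close>
  have "?P (image_mset (transpose i (Suc i)) M) = ?P M" if "i \<ge> 1" for M and i :: nat
    using *[OF _ that, of M] *[OF _ that, of "image_mset (transpose i (Suc i)) M"]
    unfolding transpose_image_mset_twice by blast
  then show ?thesis by (simp add: symmetric_series_def elem_sym_def)
qed

lemma symmetric_elem_sym_part: "symmetric_series (elem_sym_part \<mu>)"
proof (induction \<mu>)
  case empty
  then show ?case by (simp add: symmetric_series_def)
next
  case (add k \<mu>)
  then show ?case by (simp add: elem_sym_part_add symmetric_series_times symmetric_elem_sym)
qed

lemma homogeneous_elem_sym_part: "homogeneous_series (\<Sum>\<^sub># \<mu>) (elem_sym_part \<mu>)"
  using mcoeff_elem_sym_part_ne0D by (auto simp: homogeneous_series_def)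

text \<open>For nonempty \<open>M\<close> the largest index \<open>k\<close> becomes a part: weakly
  decreasing exponents make the support \<open>{1..k}\<close>, and removing one copy of it leaves a
  smaller dominant monomial.\<close>

lemma dominant_eq_lead_monom:
  assumes "dominant M"
  shows "\<exists>\<mu>. is_partition \<mu> \<and> lead_monom \<mu> = M"
  using assms
proof (induction "size M" arbitrary: M rule: less_induct)
  case less
  show ?case
  proof (cases "M = {#}")
    case True
    then show ?thesis by (intro exI[of _ "{#}"]) (simp add: is_partition_def)
  next
    case False
    let ?k = "Max (set_mset M)"
    have k: "?k \<in># M" using False by (intro Max_in) auto
    have "?k \<noteq> 0" using k less.prems unfolding dominant_def by metis
    have up: "i \<in># M" if "i \<ge> 1" "i \<le> ?k" for i
      using that(2,1)
    proof (induction rule: inc_induct)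
      case (step j)
      then show ?case using less.prems by (auto simp: dominant_def simp flip: count_greater_zero_iff
        dest!: spec[of _ j])
    qed (use k in auto)
    have S: "set_mset M = {1..?k}"
    proof (intro set_eqI iffI)
      fix x assume "x \<in># M"
      then show "x \<in> {1..?k}" using less.prems by (cases x) (auto simp: dominant_def)
    qed (use up in auto)
    define N where "N = M - mset_set {1..?k}"
    have sub: "mset_set {1..?k} \<subseteq># M"
      by (metis S mset_set_set_mset_msubset)
    have M: "M = mset_set {1..?k} + N" using sub by (simp add: N_def)
    have "dominant N"
      unfolding dominant_def
    proof (intro conjI allI impI)
      show "0 \<notin># N" using less.prems unfolding N_def dominant_def by (meson in_diffD)
      fix i :: nat assume i: "i \<ge> 1"
      show "count N (Suc i) \<le> count N i"
      \<comment> \<open>For \<open>i < k\<close> both exponents drop by one; from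
        \<open>i = k\<close> on the left one is 0.\<close>
      proof (cases "Suc i \<le> ?k")
        case True
        then show ?thesis
          using less.prems i unfolding N_def dominant_def by (simp add: count_mset_set' diff_le_mono)
      next
        case False
        then have "Suc i \<notin># M" using S by (metis atLeastAtMost_iff)
        then show ?thesis by (simp add: N_def not_in_iff)
      qed
    qed
    moreover have "size N < size M" using M \<open>?k \<noteq> 0\<close> by (metis add_less_cancel_right 
       add_0 size_union size_mset_set card_atLeastAtMost diff_Suc_1 neq0_conv)
    ultimately obtain \<mu> where "is_partition \<mu>" "lead_monom \<mu> = N" using less.hyps by blast
    then show ?thesis
      using M \<open>?k \<noteq> 0\<close> by (intro exI[of _ "add_mset ?k \<mu>"]) (auto simp: is_partition_def)
  qed
qed

text \<open>A monomial of least index sum is dominant: were the exponent at \<open>Suc i\<close>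
  larger than that at \<open>i\<close>, swapping the two indices would lower the sum.\<close>

lemma exists_dominant_le:
  assumes F: "symmetric_series F" "homogeneous_series n F" and M: "mcoeff F M \<noteq> 0"
  obtains N where "dominant N" "mcoeff F N \<noteq> 0" "\<Sum>\<^sub># N \<le> \<Sum>\<^sub># M"
proof -
  obtain N where N: "mcoeff F N \<noteq> 0" "\<And>L. mcoeff F L \<noteq> 0 \<Longrightarrow> \<Sum>\<^sub># N \<le> \<Sum>\<^sub># L"
    using ex_has_least_nat[of "\<lambda>N. mcoeff F N \<noteq> 0" M "\<lambda>N. \<Sum>\<^sub># N"] M by blast
  have dom: "dominant L" if L: "mcoeff F L \<noteq> 0" "\<Sum>\<^sub># L \<le> \<Sum>\<^sub># N" for L
    unfolding dominant_def
  proof (intro conjI allI impI)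
    show "0 \<notin># L" using F(2) L(1) by (auto simp: homogeneous_series_def)
    fix i :: nat assume i: "i \<ge> 1"
    have "(\<Sum>j\<in>#L. transpose i (Suc i) j) + count L (Suc i) = \<Sum>\<^sub># L + count L i" for L :: "nat multiset"
      by (induction L) (auto simp: transpose_def)
    from this[of L] have eq: "\<Sum>\<^sub># (image_mset (transpose i (Suc i)) L) + count L (Suc i) = \<Sum>\<^sub># L + count L i" .
    have "mcoeff F (image_mset (transpose i (Suc i)) L) \<noteq> 0"
      using F(1) L(1) i by (simp add: symmetric_series_def)
    from eq N(2)[OF this] L(2) show "count L (Suc i) \<le> count L i" by linarith
  qed
  show ?thesis using that[of N] dom[of N] N M by simp
qed

text \<open>An index \<open>j\<close> of a dominant monomial forces \<open>1, ..., j\<close> to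
  occur, so \<open>j\<close> is at most the size. This bound lets the elimination of leading terms
  terminate.\<close>

lemma dominant_sum_mset_le:
  assumes "dominant M"
  shows "\<Sum>\<^sub># M \<le> size M * size M"
proof -
  have mono: "count M j \<le> count M i" if "1 \<le> i" "i \<le> j" for i j
    using that(2)
  proof (induction rule: dec_induct)
    case (step j)
    then show ?case using assms that(1) unfolding dominant_def by (meson le_trans)
  qed simp
  then have sub: "mset_set {1..j} \<subseteq># M" if "j \<in># M" for j
    unfolding subseteq_mset_def
  proof (intro allI)
    fix i
    have "1 \<le> count M j" using that by (simp add: Suc_le_eq)
    then show "count (mset_set {1..j}) i \<le> count M i"
      using mono[of i j] order_trans[of 1 "count M j" "count M i"] by (simp add: count_mset_set')
  qed
  have "j \<le> size M" if "j \<in># M" for j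
    using size_mset_mono[OF sub[OF that]] by simp
  then have "\<Sum>\<^sub># M \<le> (\<Sum>j\<in>#M. size M)"
    using sum_mset_mono[of M "\<lambda>j. j" "\<lambda>_. size M"] by simp
  then show ?thesis by simp
qed

lemma finite_bounded_multisets: "finite {M. set_mset M \<subseteq> {..k :: nat} \<and> size M = n}"
  using finite_multisets_of_size[of "{..k}" n] by (simp add: multisets_of_size_def)

text \<open>The lower bound on index sums is raised until it exceeds the bound \<open>n * n\<close>
  for dominant monomials, where the series must be 0. A step subtracts a combination of the
  \<open>elem_sym_part \<mu>\<close> whose leading monomials have index sum exactly
  \<open>w\<close>.\<close>

lemma exists_e_expansion_aux:
  assumes "symmetric_series F" "homogeneous_series n F"
    and "\<And>M. mcoeff F M \<noteq> 0 \<Longrightarrow> n * n + 1 - k \<le> \<Sum>\<^sub># M"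
  shows "\<exists>c. is_e_expansion F c \<and> (\<forall>\<mu>. c \<mu> \<noteq> 0 \<longrightarrow> \<Sum>\<^sub># \<mu> = n)"
  using assms
proof (induction k arbitrary: F)
  case 0
  have "mcoeff F M = 0" for M
  proof (rule ccontr)
    assume "mcoeff F M \<noteq> 0"
    then obtain N where "dominant N" "mcoeff F N \<noteq> 0"
      using exists_dominant_le[OF 0(1,2)] by metis
    moreover from this have "size N = n" using 0(2) by (simp add: homogeneous_series_def)
    ultimately show False using dominant_sum_mset_le[of N] 0(3)[of N] by simp
  qed
  then show ?case by (intro exI[of _ "\<lambda>_. 0"]) (simp add: is_e_expansion_iff)
next
  case (Suc k)
  define w where "w = n * n + 1 - Suc k"
  define P where "P = {\<mu>. is_partition \<mu> \<and> \<Sum>\<^sub># \<mu> = n \<and> \<Sum>\<^sub># (lead_monom \<mu>) = w}"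
  define d where "d = (\<lambda>\<mu>. if \<mu> \<in> P
    then mcoeff F (lead_monom \<mu>) / mcoeff (elem_sym_part \<mu>) (lead_monom \<mu>) else 0)"
  \<comment> \<open>Positive parts with sum \<open>n\<close> number at most \<open>n\<close> and are
    at most \<open>n\<close> each, so \<open>P\<close> is finite.\<close>
  have "P \<subseteq> (\<Union>m\<le>n. {\<mu>. set_mset \<mu> \<subseteq> {..n} \<and> size \<mu> = m})"
  proof
    fix \<mu> assume "\<mu> \<in> P"
    then have \<mu>: "0 \<notin># \<mu>" "\<Sum>\<^sub># \<mu> = n" by (auto simp: P_def is_partition_def)
    have "size \<mu> \<le> \<Sum>\<^sub># \<mu>" using \<mu>(1) by (induction \<mu>) auto
    moreover have "j \<le> \<Sum>\<^sub># \<mu>" if "j \<in># \<mu>" for j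
      using that by (auto dest!: multi_member_split)
    ultimately show "\<mu> \<in> (\<Union>m\<le>n. {\<mu>. set_mset \<mu> \<subseteq> {..n} \<and> size \<mu> = m})" using \<mu>(2) by auto
  qed
  then have finP: "finite P" by (rule finite_subset) (simp add: finite_bounded_multisets)
  then have find: "finite {\<mu>. d \<mu> \<noteq> 0}" by (rule rev_finite_subset) (auto simp: d_def)
  define E where "E = (\<Sum>\<mu> | d \<mu> \<noteq> 0. d \<mu> *\<^sub>s elem_sym_part \<mu>)"
  have E: "is_e_expansion E d"
    using find unfolding is_e_expansion_def E_def by (auto simp: d_def P_def)
  have mE: "mcoeff E M = (\<Sum>\<mu>\<in>P. d \<mu> * mcoeff (elem_sym_part \<mu>) M)" for M
    unfolding E_def mcoeff_sum mcoeff_smult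
    by (intro sum.mono_neutral_left finP) (auto simp: d_def)
  have mE0: "\<exists>\<mu>\<in>P. mcoeff (elem_sym_part \<mu>) M \<noteq> 0" if "mcoeff E M \<noteq> 0" for M
    using that sum.neutral[of P "\<lambda>\<mu>. d \<mu> * mcoeff (elem_sym_part \<mu>) M"] unfolding mE
    by (metis mult_zero_right)
  let ?G = "F - 1 *\<^sub>s E"
  have G1: "symmetric_series ?G"
    using Suc.prems(1) symmetric_elem_sym_part by (simp add: symmetric_series_def mE)
  have G2: "homogeneous_series n ?G"
    unfolding homogeneous_series_def
  proof (intro allI impI)
    fix M assume "mcoeff ?G M \<noteq> 0"
    then consider "mcoeff F M \<noteq> 0" | "mcoeff E M \<noteq> 0"
      by (cases "mcoeff F M = 0") auto
    then show "size M = n \<and> 0 \<notin># M"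
    proof cases
      case 2
      from mE0[OF this] show ?thesis using mcoeff_elem_sym_part_ne0D by (auto simp: P_def)
    qed (use Suc.prems(2) in \<open>auto simp: homogeneous_series_def\<close>)
  qed
  have Gw: "w \<le> \<Sum>\<^sub># M" if "mcoeff ?G M \<noteq> 0" for M
  proof -
    from that consider "mcoeff F M \<noteq> 0" | "mcoeff E M \<noteq> 0"
      by (cases "mcoeff F M = 0") auto
    then show ?thesis
    proof cases
      case 2
      from mE0[OF this] show ?thesis using mcoeff_elem_sym_part_ne0D by (auto simp: P_def)
    qed (use Suc.prems(3) in \<open>auto simp: w_def\<close>)
  qed
  \<comment> \<open>Distinct members of \<open>P\<close> have distinct leading monomials of the same
    index sum, so none contributes to that of another: the system for \<open>d\<close> is
    diagonal.\<close>
  have G0: "mcoeff ?G M = 0" if M: "dominant M" "\<Sum>\<^sub># M = w" for M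
  proof (cases "size M = n")
    case True
    obtain \<mu> where \<mu>: "is_partition \<mu>" "lead_monom \<mu> = M" using dominant_eq_lead_monom M by blast
    have "size M = \<Sum>\<^sub># \<mu>"
      using mcoeff_elem_sym_part_ne0D mcoeff_lead_monom_pos[of \<mu>] \<mu>(2) by (metis less_irrefl)
    then have P: "\<mu> \<in> P" using True \<mu> M by (simp add: P_def)
    have "mcoeff E M = (\<Sum>\<nu>\<in>{\<mu>}. d \<nu> * mcoeff (elem_sym_part \<nu>) M)"
      unfolding mE
    proof (intro sum.mono_neutral_right finP ballI)
      fix \<nu> assume \<nu>: "\<nu> \<in> P - {\<mu>}"
      then have "M \<noteq> lead_monom \<nu>" using lead_monom_inj[of \<mu> \<nu>] \<mu> by (auto simp: P_def)
      moreover have "\<Sum>\<^sub># (lead_monom \<nu>) = \<Sum>\<^sub># M" using \<nu> M by (simp add: P_def)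
      ultimately show "d \<nu> * mcoeff (elem_sym_part \<nu>) M = 0"
        using mcoeff_elem_sym_part_ne0D[of \<nu> M] by auto
    qed (use P in auto)
    also have "\<dots> = mcoeff F M"
      using P \<mu>(2) mcoeff_lead_monom_pos[of \<mu>] by (simp add: d_def)
    finally show ?thesis by simp
  qed (use G2 in \<open>auto simp: homogeneous_series_def\<close>)
  \<comment> \<open>A monomial of index sum \<open>w\<close> in \<open>?G\<close> would yield a
    dominant one of that sum, which \<open>G0\<close> excludes.\<close>
  have "w < \<Sum>\<^sub># M" if M: "mcoeff ?G M \<noteq> 0" for M
  proof -
    obtain N where N: "dominant N" "mcoeff ?G N \<noteq> 0" "\<Sum>\<^sub># N \<le> \<Sum>\<^sub># M"
      using exists_dominant_le[OF G1 G2 M] by metis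
    then show ?thesis using G0[of N] Gw[of N] by linarith
  qed
  then have "\<exists>c. is_e_expansion ?G c \<and> (\<forall>\<mu>. c \<mu> \<noteq> 0 \<longrightarrow> \<Sum>\<^sub># \<mu> = n)"
    by (intro Suc.IH G1 G2) (fastforce simp: w_def)
  then obtain c where c: "is_e_expansion ?G c" "\<And>\<mu>. c \<mu> \<noteq> 0 \<Longrightarrow> \<Sum>\<^sub># \<mu> = n" by blast
  have "?G - (-1) *\<^sub>s E = F" by (rule pseries_eqI) simp
  then have "is_e_expansion F (\<lambda>\<mu>. c \<mu> - (-1) * d \<mu>)"
    using e_expansion_lincomb[OF c(1) E, of "-1"] by metis
  moreover have "\<Sum>\<^sub># \<mu> = n" if "c \<mu> - (-1) * d \<mu> \<noteq> 0" for \<mu>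
  proof (cases "c \<mu> = 0")
    case True
    then show ?thesis using that by (auto simp: d_def P_def split: if_splits)
  qed (use c(2) in auto)
  ultimately show ?case by blast
qed

lemma exists_e_expansion:
  assumes "symmetric_series F" "homogeneous_series n F"
  obtains c where "is_e_expansion F c" "\<And>\<mu>. c \<mu> \<noteq> 0 \<Longrightarrow> \<Sum>\<^sub># \<mu> = n"
  \<comment> \<open>For \<open>k = n * n + 1\<close> the lower bound on the index sums is 0 and
    holds trivially.\<close>
  using exists_e_expansion_aux[OF assms, of "n * n + 1"] by auto

section \<open>The linear coefficient of the chromatic polynomial\<close>

text \<open>An arbitrary relation \<open>E\<close> in place of a graph lets single arcs be deleted
  and contracted, and admits loops.\<close>

definition proper_maps :: "'a set \<Rightarrow> ('a \<times> 'a) set \<Rightarrow> 'b set \<Rightarrow> ('a \<Rightarrow> 'b) set" where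
  "proper_maps V E C = {\<kappa> \<in> V \<rightarrow>\<^sub>E C. \<forall>(x, y)\<in>E. \<kappa> x \<noteq> \<kappa> y}"

lemma finite_proper_maps: "finite V \<Longrightarrow> finite C \<Longrightarrow> finite (proper_maps V E C)"
  unfolding proper_maps_def by (rule finite_subset[of _ "V \<rightarrow>\<^sub>E C"]) (auto intro: finite_PiE)

definition contract :: "'a \<Rightarrow> 'a \<Rightarrow> 'a \<Rightarrow> 'a" where
  "contract u v x = (if x = v then u else x)"

text \<open>Deletion-contraction: maps proper for \<open>E\<close> are split by whether
  \<open>u\<close> and \<open>v\<close> differ in color; those with equal colors are the proper maps
  of the contraction.\<close>

lemma card_proper_maps_insert:
  assumes V: "finite V" "finite C" "E \<subseteq> V \<times> V" "u \<in> V" "v \<in> V" "u \<noteq> v"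
  shows "card (proper_maps V E C) = card (proper_maps V (insert (u, v) E) C)
    + card (proper_maps (V - {v}) (map_prod (contract u v) (contract u v) ` E) C)"
proof -
  let ?f = "contract u v" and ?D = "{\<kappa> \<in> proper_maps V E C. \<kappa> u = \<kappa> v}"
  have split: "proper_maps V E C = proper_maps V (insert (u, v) E) C \<union> ?D"
    by (auto simp: proper_maps_def)
  have "bij_betw (\<lambda>\<kappa>. restrict \<kappa> (V - {v})) ?D (proper_maps (V - {v}) (map_prod ?f ?f ` E) C)"
  proof (rule bij_betw_byWitness[where f' = "\<lambda>\<kappa>. \<kappa>(v := \<kappa> u)"])
    show "\<forall>\<kappa>\<in>?D. (restrict \<kappa> (V - {v}))(v := restrict \<kappa> (V - {v}) u) = \<kappa>"
      using V by (auto simp: proper_maps_def fun_eq_iff PiE_def extensional_def)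
    show "\<forall>\<kappa>\<in>proper_maps (V - {v}) (map_prod ?f ?f ` E) C. restrict (\<kappa>(v := \<kappa> u)) (V - {v}) = \<kappa>"
      by (auto simp: proper_maps_def fun_eq_iff PiE_def extensional_def)
    show "(\<lambda>\<kappa>. restrict \<kappa> (V - {v})) ` ?D \<subseteq> proper_maps (V - {v}) (map_prod ?f ?f ` E) C"
    proof safe
      fix \<kappa> assume \<kappa>: "\<kappa> \<in> proper_maps V E C" "\<kappa> u = \<kappa> v"
      have "restrict \<kappa> (V - {v}) (?f x) = \<kappa> x" if "x \<in> V" for x
        using that V \<kappa>(2) by (auto simp: contract_def)
      then show "restrict \<kappa> (V - {v}) \<in> proper_maps (V - {v}) (map_prod ?f ?f ` E) C"
        using \<kappa>(1) V(3) by (fastforce simp: proper_maps_def)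
    qed
    show "(\<lambda>\<kappa>. \<kappa>(v := \<kappa> u)) ` proper_maps (V - {v}) (map_prod ?f ?f ` E) C \<subseteq> ?D"
    proof safe
      fix \<kappa> assume \<kappa>: "\<kappa> \<in> proper_maps (V - {v}) (map_prod ?f ?f ` E) C"
      have "(\<kappa>(v := \<kappa> u)) x = \<kappa> (?f x)" for x by (auto simp: contract_def)
      moreover have "\<forall>(x, y)\<in>E. \<kappa> (?f x) \<noteq> \<kappa> (?f y)" using \<kappa> by (auto simp: proper_maps_def)
      moreover have "\<kappa>(v := \<kappa> u) \<in> V \<rightarrow>\<^sub>E C"
        using \<kappa> V by (auto simp: proper_maps_def PiE_def extensional_def Pi_def)
      ultimately show "\<kappa>(v := \<kappa> u) \<in> proper_maps V E C"
        by (auto simp: proper_maps_def)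
      show "(\<kappa>(v := \<kappa> u)) u = (\<kappa>(v := \<kappa> u)) v" using V by simp
    qed
  qed
  then have "card ?D = card (proper_maps (V - {v}) (map_prod ?f ?f ` E) C)"
    by (rule bij_betw_same_card)
  moreover have "card (proper_maps V E C) = card (proper_maps V (insert (u, v) E) C) + card ?D"
  proof (subst split, rule card_Un_disjoint)
    show "finite (proper_maps V (insert (u, v) E) C)" using finite_proper_maps[OF V(1,2)] .
    show "finite ?D" using finite_proper_maps[OF V(1,2)] by simp
  qed (auto simp: proper_maps_def)
  ultimately show ?thesis by simp
qed

definition connected_rel :: "'a set \<Rightarrow> ('a \<times> 'a) set \<Rightarrow> bool" where
  "connected_rel V E \<longleftrightarrow> V \<noteq> {} \<and> (\<forall>x\<in>V. \<forall>y\<in>V. (x, y) \<in> (E \<union> E\<inverse>)\<^sup>*)"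

text \<open>Contraction maps walks to walks, the arc \<open>(u, v)\<close> collapsing to a
  point.\<close>

lemma connected_rel_contract:
  assumes "connected_rel V (insert (u, v) E)" "u \<in> V" "u \<noteq> v"
  shows "connected_rel (V - {v}) (map_prod (contract u v) (contract u v) ` E)"
proof -
  let ?f = "contract u v"
  let ?E = "insert (u, v) E" and ?E' = "map_prod ?f ?f ` E"
  have *: "(?f x, ?f y) \<in> (?E' \<union> ?E'\<inverse>)\<^sup>*" if "(x, y) \<in> (?E \<union> ?E\<inverse>)\<^sup>*" for x y
    using that
  proof (induction rule: rtrancl_induct)
    case (step y z)
    have "?f u = ?f v" by (simp add: contract_def)
    then have "?f y = ?f z \<or> (?f y, ?f z) \<in> ?E' \<union> ?E'\<inverse>" using step(2) by (force simp: image_iff)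
    then show ?case using step(3) by (metis rtrancl.rtrancl_into_rtrancl)
  qed simp
  show ?thesis
    unfolding connected_rel_def
  proof (intro conjI ballI)
    fix x y assume xy: "x \<in> V - {v}" "y \<in> V - {v}"
    then have "(x, y) \<in> (?E \<union> ?E\<inverse>)\<^sup>*" using assms(1) by (auto simp: connected_rel_def)
    from *[OF this] show "(x, y) \<in> (?E' \<union> ?E'\<inverse>)\<^sup>*" using xy by (auto simp: contract_def)
  qed (use assms in auto)
qed

text \<open>The sign of the linear coefficient alternates with the number of vertices, so after
  normalization deletion-contraction adds two nonnegative numbers. The weak inequality covers all
  relations because the strict one is available for only one summand at a time.\<close>

lemma exists_chromatic_poly:
  assumes "finite V" "finite E" "E \<subseteq> V \<times> V" "V \<noteq> {}"
  shows "\<exists>p :: rat poly. (\<forall>N. poly p (of_nat N) = of_nat (card (proper_maps V E {1..N :: nat}))) \<and>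
    (-1) ^ (card V - 1) * coeff p 1 \<ge> 0 \<and>
    (connected_rel V E \<longrightarrow> irrefl E \<longrightarrow> (-1) ^ (card V - 1) * coeff p 1 > 0)"
  using assms
proof (induction "card E" arbitrary: V E rule: less_induct)
  case less
  note fin = \<open>finite V\<close> \<open>finite E\<close> and sub = \<open>E \<subseteq> V \<times> V\<close>
  have cV: "card V > 0" using less.prems by (simp add: card_gt_0_iff)
  consider "E = {}" | w where "(w, w) \<in> E" | "irrefl E" "E \<noteq> {}" by (auto simp: irrefl_def)
  then show ?case
  proof cases
    case 1
    \<comment> \<open>Without arcs the polynomial is \<open>x ^ card V\<close>, and connectedness
      leaves a single vertex.\<close>
    have "x = y" if "connected_rel V {}" "x \<in> V" "y \<in> V" for x y
      using that by (auto simp: connected_rel_def)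
    then have "card V = 1" if "connected_rel V E"
      using that 1 cV card_le_Suc0_iff_eq[OF fin(1)] by fastforce
    moreover have "proper_maps V E {1..N} = V \<rightarrow>\<^sub>E {1..N}" for N :: nat
      using 1 by (auto simp: proper_maps_def)
    ultimately show ?thesis
      using cV fin by (intro exI[of _ "monom 1 (card V)"]) (auto simp: poly_monom card_funcsetE)
  next
    case 2
    then have "proper_maps V E C = {}" for C :: "nat set" by (auto simp: proper_maps_def)
    then show ?thesis using 2 by (intro exI[of _ 0]) (auto simp: irrefl_def)
  next
    case 3
    then obtain u v where uv: "(u, v) \<in> E" by auto
    then have ne: "u \<noteq> v" using 3 by (auto simp: irrefl_def)
    have V: "u \<in> V" "v \<in> V" using uv sub by auto
    let ?f = "contract u v"
    define E' where "E' = E - {(u, v)}"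
    define F where "F = map_prod ?f ?f ` E'"
    have E: "E = insert (u, v) E'" using uv by (auto simp: E'_def)
    have E': "finite E'" "E' \<subseteq> V \<times> V" "card E' < card E"
      using fin sub card_Diff1_less[OF fin(2) uv] by (auto simp: E'_def)
    have F: "finite F" "F \<subseteq> (V - {v}) \<times> (V - {v})"
      using E' V ne by (auto simp: F_def contract_def split: if_splits)
    have cF: "card F < card E" using card_image_le[OF E'(1), of "map_prod ?f ?f"] E'(3) by (simp add: F_def)
    have V': "finite (V - {v})" "V - {v} \<noteq> {}" using fin V ne by auto
    obtain p where p: "\<And>N. poly p (of_nat N) = of_nat (card (proper_maps V E' {1..N}))"
      "(-1) ^ (card V - 1) * coeff p 1 \<ge> (0 :: rat)"
      "connected_rel V E' \<Longrightarrow> irrefl E' \<Longrightarrow> (-1) ^ (card V - 1) * coeff p 1 > 0"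
      using less.hyps[OF E'(3) fin(1) E'(1,2) less.prems(4)] by blast
    obtain q where q: "\<And>N. poly q (of_nat N) = of_nat (card (proper_maps (V - {v}) F {1..N}))"
      "(-1) ^ (card (V - {v}) - 1) * coeff q 1 \<ge> (0 :: rat)"
      "connected_rel (V - {v}) F \<Longrightarrow> irrefl F \<Longrightarrow> (-1) ^ (card (V - {v}) - 1) * coeff q 1 > 0"
      using less.hyps[OF cF V'(1) F V'(2)] by blast
    \<comment> \<open>Contraction loses one vertex, which turns the difference of polynomials into a
      sum of normalized coefficients.\<close>
    have "card (V - {v}) = card V - 1" "card V \<ge> 2"
      using V ne card_mono[OF fin(1), of "{u, v}"] by (simp_all add: card_Diff_singleton)
    then have "card V - 1 = Suc (card (V - {v}) - 1)" by simp
    then have c: "(-1) ^ (card V - 1) * coeff (p - q) 1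
      = (-1) ^ (card V - 1) * coeff p 1 + (-1) ^ (card (V - {v}) - 1) * coeff q 1"
      by (simp add: algebra_simps)
    have "poly (p - q) (of_nat N) = of_nat (card (proper_maps V E {1..N}))" for N
      using card_proper_maps_insert[OF fin(1) _ E'(2) V ne, of "{1..N}"]
      by (simp add: p(1) q(1) E F_def)
    moreover have "(-1) ^ (card V - 1) * coeff (p - q) 1 > 0" if con: "connected_rel V E"
    \<comment> \<open>A loopless contraction supplies the strict inequality. A loop in it can only
      stem from the opposite arc \<open>(v, u)\<close>; then deleting \<open>(u, v)\<close>
      preserves connectedness, and the deletion supplies it.\<close>
    proof (cases "irrefl F")
      case True
      have "connected_rel (V - {v}) F"
        using connected_rel_contract con V(1) ne unfolding E F_def by metis
      then show ?thesis using q(3) True p(2) c by linarith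
    next
      case False
      then obtain x y where xy: "(x, y) \<in> E'" "?f x = ?f y" by (auto simp: irrefl_def F_def)
      then have "x \<noteq> y" "(x, y) \<noteq> (u, v)" using 3 by (auto simp: irrefl_def E'_def)
      then have "(v, u) \<in> E'" using xy by (auto simp: contract_def split: if_splits)
      then have "E \<union> E\<inverse> = E' \<union> E'\<inverse>" unfolding E by auto
      then have "connected_rel V E'" using con by (simp add: connected_rel_def)
      moreover have "irrefl E'" using 3 by (auto simp: irrefl_def E'_def)
      ultimately show ?thesis using p(3) q(2) c by linarith
    qed
    ultimately show ?thesis using c p(2) q(2) by (intro exI[of _ "p - q"]) auto
  qed
qed

section \<open>Specialization to finitely many ones\<close>

text \<open>The degree \<open>m\<close> part at \<open>x_1 = ... = x_N = 1\<close> and all other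
  variables 0; fixing the degree keeps the sum finite.\<close>

definition specialize :: "nat \<Rightarrow> nat \<Rightarrow> pseries \<Rightarrow> rat" where
  "specialize m N F = (\<Sum>M\<in>multisets_of_size {1..N} m. mcoeff F M)"

lemma specialize_one [simp]: "specialize 0 N 1 = 1"
proof -
  have "multisets_of_size {1..N} 0 = {{#}}" by (auto simp: multisets_of_size_def)
  then show ?thesis by (simp add: specialize_def)
qed

lemma specialize_elem_sym: "specialize k N (elem_sym k) = of_nat (N choose k)"
proof -
  let ?B = "{S. S \<subseteq> {1..N} \<and> card S = k}"
  have fin: "finite S" if "S \<in> ?B" for S using that finite_subset[of S "{1..N}"] by simp
  have sub: "mset_set ` ?B \<subseteq> multisets_of_size {1..N} k"
  proof safe
    fix S assume "S \<subseteq> {1..N}" "k = card S"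
    moreover from this have "finite S" using fin by blast
    ultimately show "mset_set S \<in> multisets_of_size {1..N} (card S)"
      by (simp add: multisets_of_size_def)
  qed
  have "specialize k N (elem_sym k) = (\<Sum>M\<in>mset_set ` ?B. mcoeff (elem_sym k) M)"
    unfolding specialize_def
  proof (rule sum.mono_neutral_right[OF finite_multisets_of_size sub])
    show "\<forall>M\<in>multisets_of_size {1..N} k - mset_set ` ?B. mcoeff (elem_sym k) M = 0"
    proof
      fix M assume M: "M \<in> multisets_of_size {1..N} k - mset_set ` ?B"
      show "mcoeff (elem_sym k) M = 0"
      proof (rule ccontr)
        assume "mcoeff (elem_sym k) M \<noteq> 0"
        then obtain S where S: "finite S" "card S = k" "M = mset_set S" by (rule mcoeff_elem_sym_ne0D)
        then have "S \<in> ?B" using M by (auto simp: multisets_of_size_def)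
        then show False using M S by blast
      qed
    qed
  qed simp
  also have "\<dots> = (\<Sum>M\<in>mset_set ` ?B. 1)"
  proof (rule sum.cong[OF refl])
    fix M assume "M \<in> mset_set ` ?B"
    then obtain S where "S \<in> ?B" "M = mset_set S" by blast
    then show "mcoeff (elem_sym k) M = 1" using fin[of S]
      by (auto simp: elem_sym_def)
  qed
  also have "\<dots> = of_nat (card ?B)"
  proof -
    have "inj_on mset_set ?B"
      by (rule inj_on_inverseI[of _ set_mset]) (rule finite_set_mset_mset_set[OF fin])
    then show ?thesis by (simp add: card_image)
  qed
  finally show ?thesis by (simp add: n_subsets)
qed

text \<open>Homogeneity kills every splitting into sizes other than \<open>k\<close> and
  \<open>m\<close>; what remains is all pairs of monomials of these degrees.\<close>

lemma specialize_times:
  assumes "homogeneous_series k F" "homogeneous_series m G"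
  shows "specialize (k + m) N (F * G) = specialize k N F * specialize m N G"
proof -
  let ?T = "multisets_of_size {1..N}"
  let ?S = "Sigma (?T (k + m)) (\<lambda>M. {(A, B). A + B = M})"
  let ?f = "\<lambda>(A, B). mcoeff F A * mcoeff G B"
  let ?R = "{p \<in> ?S. snd p \<in> ?T k \<times> ?T m}"
  have fin: "finite (?T j)" for j by (simp add: finite_multisets_of_size)
  have "specialize (k + m) N (F * G) = (\<Sum>p\<in>?S. ?f (snd p))"
    unfolding specialize_def mcoeff_times
    by (subst sum.Sigma) (use finite_mset_splits in \<open>auto simp: fin case_prod_unfold\<close>)
  also have "\<dots> = (\<Sum>p\<in>?R. ?f (snd p))"
  proof (rule sum.mono_neutral_right)
    show "finite ?S" by (intro finite_SigmaI fin finite_mset_splits)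
    show "\<forall>p\<in>?S - ?R. ?f (snd p) = 0"
    proof
      fix p assume p: "p \<in> ?S - ?R"
      obtain A B where [simp]: "p = (A + B, A, B)" using p by auto
      have "size A \<noteq> k \<or> size B \<noteq> m" using p by (auto simp: multisets_of_size_def)
      then show "?f (snd p) = 0" using assms by (auto simp: homogeneous_series_def)
    qed
  qed auto
  also have "\<dots> = (\<Sum>q\<in>?T k \<times> ?T m. ?f q)"
    by (rule sum.reindex_bij_witness[where i = "\<lambda>(A, B). (A + B, A, B)" and j = snd])
      (fastforce simp: multisets_of_size_def)+
  also have "\<dots> = specialize k N F * specialize m N G"
    by (simp add: specialize_def sum_product sum.cartesian_product)
  finally show ?thesis .
qed

lemma specialize_elem_sym_part:
  "specialize (\<Sum>\<^sub># \<mu>) N (elem_sym_part \<mu>) = (\<Prod>k\<in>#\<mu>. of_nat (N choose k))"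
proof (induction \<mu>)
  case (add k \<mu>)
  have "homogeneous_series k (elem_sym k)"
    using homogeneous_elem_sym_part[of "{#k#}"] by (simp add: elem_sym_part_def)
  then show ?case
    using add by (simp add: elem_sym_part_add specialize_times specialize_elem_sym
        homogeneous_elem_sym_part)
qed simp

section \<open>Symmetry and specialization of the chromatic symmetric function\<close>

lemma mcoeff_chromatic_sym:
  "mcoeff (chromatic_sym G) M =
     of_nat (card {\<kappa> \<in> proper_colorings G. image_mset \<kappa> (mset_set (pverts G)) = M})"
  by (simp add: chromatic_sym_def)

lemma mcoeff_chromatic_sym_ne0D:
  assumes "mcoeff (chromatic_sym G) M \<noteq> 0"
  obtains \<kappa> where "\<kappa> \<in> proper_colorings G" "image_mset \<kappa> (mset_set (pverts G)) = M"
proof -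
  have "{\<kappa> \<in> proper_colorings G. image_mset \<kappa> (mset_set (pverts G)) = M} \<noteq> {}"
    using assms unfolding mcoeff_chromatic_sym by (metis card.empty of_nat_0)
  then show ?thesis using that by blast
qed

lemma homogeneous_chromatic_sym:
  assumes "finite (pverts G)"
  shows "homogeneous_series (card (pverts G)) (chromatic_sym G)"
  unfolding homogeneous_series_def
proof (intro allI impI)
  fix M assume "mcoeff (chromatic_sym G) M \<noteq> 0"
  then obtain \<kappa> where "\<kappa> \<in> proper_colorings G" "image_mset \<kappa> (mset_set (pverts G)) = M"
    by (rule mcoeff_chromatic_sym_ne0D)
  then show "size M = card (pverts G) \<and> 0 \<notin># M"
    using assms by (force simp: proper_colorings_def PiE_def Pi_def)
qed

text \<open>Exchanging the colors \<open>i\<close> and \<open>Suc i\<close> is an involution on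
  proper colorings that swaps the two indices in the monomial; \<open>i \<ge> 1\<close> keeps the
  colors positive.\<close>

lemma symmetric_chromatic_sym:
  assumes V: "finite (pverts G)" and wf: "parcs G \<subseteq> pverts G \<times> pverts G"
  shows "symmetric_series (chromatic_sym G)"
  unfolding symmetric_series_def
proof (intro allI impI)
  fix M and i :: nat assume i: "i \<ge> 1"
  let ?V = "pverts G" and ?t = "transpose i (Suc i)"
  let ?K = "\<lambda>M. {\<kappa> \<in> proper_colorings G. image_mset \<kappa> (mset_set ?V) = M}"
  define h where "h = (\<lambda>\<kappa>. \<lambda>x\<in>?V. ?t (\<kappa> x))"
  have h: "h \<kappa> \<in> ?K (image_mset ?t L)" if "\<kappa> \<in> ?K L" for \<kappa> L
  proof -
    have "image_mset (h \<kappa>) (mset_set ?V) = image_mset (?t \<circ> \<kappa>) (mset_set ?V)"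
      using V by (intro image_mset_cong) (auto simp: h_def)
    also have "\<dots> = image_mset ?t L" using that by (auto simp: multiset.map_comp)
    finally have "image_mset (h \<kappa>) (mset_set ?V) = image_mset ?t L" .
    moreover have "?t (\<kappa> x) \<ge> 1" if "x \<in> ?V" for x
    proof -
      have "\<kappa> x \<ge> 1" using \<open>\<kappa> \<in> ?K L\<close> that by (auto simp: proper_colorings_def)
      then show ?thesis using i by (auto simp: transpose_def)
    qed
    moreover have "?t (\<kappa> x) \<noteq> ?t (\<kappa> y)" if "(x, y) \<in> parcs G" for x y
      using that \<open>\<kappa> \<in> ?K L\<close> by (auto simp: proper_colorings_def transpose_eq_iff)
    ultimately show ?thesis
      using wf by (fastforce simp: proper_colorings_def h_def)
  qed
  have hh: "h (h \<kappa>) = \<kappa>" if "\<kappa> \<in> ?K L" for \<kappa> L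
    using that by (auto simp: h_def proper_colorings_def fun_eq_iff PiE_def extensional_def)
  have "bij_betw h (?K M) (?K (image_mset ?t M))"
  proof (rule bij_betw_byWitness[where f' = h])
    show "h ` ?K (image_mset ?t M) \<subseteq> ?K M"
      using h[of _ "image_mset ?t M"] unfolding transpose_image_mset_twice by (rule image_subsetI)
    show "h ` ?K M \<subseteq> ?K (image_mset ?t M)" using h[of _ M] by (rule image_subsetI)
    show "\<forall>\<kappa>\<in>?K M. h (h \<kappa>) = \<kappa>" using hh[of _ M] by (rule ballI)
    show "\<forall>\<kappa>\<in>?K (image_mset ?t M). h (h \<kappa>) = \<kappa>" using hh[of _ "image_mset ?t M"] by (rule ballI)
  qed
  from bij_betw_same_card[OF this]
  show "mcoeff (chromatic_sym G) (image_mset ?t M) = mcoeff (chromatic_sym G) M"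
    by (simp only: mcoeff_chromatic_sym)
qed

lemma specialize_chromatic_sym:
  assumes "finite (pverts G)"
  shows "specialize (card (pverts G)) N (chromatic_sym G) =
    of_nat (card (proper_maps (pverts G) (parcs G) {1..N}))"
proof -
  let ?V = "pverts G" and ?P = "proper_maps (pverts G) (parcs G) {1..N}"
  let ?T = "multisets_of_size {1..N} (card ?V)" and ?g = "\<lambda>\<kappa>. image_mset \<kappa> (mset_set ?V)"
  have P: "{\<kappa> \<in> proper_colorings G. ?g \<kappa> = M} = {\<kappa> \<in> ?P. ?g \<kappa> = M}" if "M \<in> ?T" for M
  proof -
    have "\<kappa> ` ?V \<subseteq> {1..N}" if "?g \<kappa> = M" for \<kappa>
      using that \<open>M \<in> ?T\<close> assms by (auto simp: multisets_of_size_def)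
    then show ?thesis by (auto simp: proper_colorings_def proper_maps_def PiE_def Pi_def image_subset_iff)
  qed
  have "?g ` ?P \<subseteq> ?T"
    using assms PiE_mem[of _ ?V "\<lambda>_. {1..N}"]
    by (fastforce simp: multisets_of_size_def proper_maps_def)
  then have "(\<Sum>M\<in>?T. card {\<kappa> \<in> ?P. ?g \<kappa> = M}) = card ?P"
    using sum.group[of ?P ?T ?g "\<lambda>_. 1 :: nat"] assms
    by (simp add: finite_proper_maps finite_multisets_of_size)
  then have "of_nat (card ?P) = (\<Sum>M\<in>?T. of_nat (card {\<kappa> \<in> ?P. ?g \<kappa> = M}) :: rat)"
    by (simp only: flip: of_nat_sum)
  then show ?thesis by (simp add: specialize_def mcoeff_chromatic_sym P)
qed

section \<open>Nonvanishing of the coefficient of \<open>e_n\<close> for connected graphs\<close>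

definition binomial_poly :: "nat \<Rightarrow> rat poly" where
  "binomial_poly k = smult (1 / fact k) (\<Prod>i=0..<k. [:- of_nat i, 1:])"

lemma poly_binomial_poly: "poly (binomial_poly k) (of_nat N) = of_nat (N choose k)"
  by (simp add: binomial_poly_def binomial_gbinomial gbinomial_prod_rev poly_prod)

lemma dvd_binomial_poly: "k > 0 \<Longrightarrow> [:0, 1:] dvd binomial_poly k"
proof -
  assume "k > 0"
  then have "poly (binomial_poly k) 0 = 0" using poly_binomial_poly[of k 0] by (simp add: binomial_eq_0)
  then show ?thesis unfolding poly_eq_0_iff_dvd by simp
qed

text \<open>Two factors with positive \<open>k\<close> are each divisible by \<open>x\<close>, hence
  the product by the square of \<open>x\<close>.\<close>

lemma coeff_prod_binomial_poly:
  assumes "is_partition \<mu>" "size \<mu> \<ge> 2"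
  shows "coeff (\<Prod>k\<in>#\<mu>. binomial_poly k) 1 = 0"
proof -
  obtain k \<nu> where k: "\<mu> = add_mset k \<nu>" using assms(2) by (cases \<mu>) auto
  moreover obtain l \<nu>' where "\<nu> = add_mset l \<nu>'" using assms(2) k by (cases \<nu>) auto
  ultimately have \<mu>: "\<mu> = add_mset k (add_mset l \<nu>')" by simp
  have "[:0, 1:] dvd binomial_poly k" "[:0, 1:] dvd binomial_poly l"
    using assms(1) by (auto simp: \<mu> is_partition_def intro!: dvd_binomial_poly)
  then obtain p q where "binomial_poly k = [:0, 1:] * p" "binomial_poly l = [:0, 1:] * q"
    by (auto elim!: dvdE)
  then show ?thesis by (simp add: \<mu> coeff_pCons mult.left_commute)
qed

lemma two_le_size_if_ne_single:
  fixes \<mu> :: "nat multiset"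
  assumes "\<mu> \<noteq> {#n#}" "\<Sum>\<^sub># \<mu> = n" "n \<ge> 1"
  shows "size \<mu> \<ge> 2"
proof -
  obtain k \<nu> where "\<mu> = add_mset k \<nu>" using assms by (cases \<mu>) auto
  then show ?thesis using assms by (cases \<nu>) auto
qed

lemma chromatic_e_coeff_ne_0:
  assumes V: "finite (pverts G)" "card (pverts G) = n"
    and G: "parcs G \<subseteq> pverts G \<times> pverts G" "irrefl (parcs G)" "connected_rel (pverts G) (parcs G)"
    and c: "is_e_expansion (chromatic_sym G) c" "\<And>\<mu>. c \<mu> \<noteq> 0 \<Longrightarrow> \<Sum>\<^sub># \<mu> = n"
  shows "c {#n#} \<noteq> 0"
proof
  assume 0: "c {#n#} = 0"
  have "pverts G \<noteq> {}" using G(3) by (simp add: connected_rel_def)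
  moreover have "finite (parcs G)" using G(1) V(1) finite_subset by blast
  ultimately obtain p :: "rat poly" where
    p: "\<And>N. poly p (of_nat N) = of_nat (card (proper_maps (pverts G) (parcs G) {1..N :: nat}))"
      "(-1) ^ (card (pverts G) - 1) * coeff p 1 > 0"
    using exists_chromatic_poly[OF V(1) _ G(1)] G(2,3) by blast
  \<comment> \<open>The specialized expansion, with the number \<open>N\<close> of variables as the
    indeterminate.\<close>
  define q where "q = (\<Sum>\<mu> | c \<mu> \<noteq> 0. smult (c \<mu>) (\<Prod>k\<in>#\<mu>. binomial_poly k))"
  have prod: "poly (\<Prod>k\<in>#\<mu>. binomial_poly k) (of_nat N) = (\<Prod>k\<in>#\<mu>. of_nat (N choose k))" for \<mu> N
    by (induction \<mu>) (simp_all add: poly_binomial_poly)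
  have "poly p (of_nat N) = poly q (of_nat N)" for N
  proof -
    have "poly p (of_nat N) = specialize n N (chromatic_sym G)"
      using specialize_chromatic_sym[OF V(1), of N] p(1) V(2) by simp
    also have "\<dots> = (\<Sum>M\<in>multisets_of_size {1..N} n. \<Sum>\<mu> | c \<mu> \<noteq> 0. c \<mu> * mcoeff (elem_sym_part \<mu>) M)"
      using c(1) by (simp add: specialize_def is_e_expansion_iff)
    also have "\<dots> = (\<Sum>\<mu> | c \<mu> \<noteq> 0. c \<mu> * specialize n N (elem_sym_part \<mu>))"
      unfolding specialize_def sum_distrib_left by (rule sum.swap)
    also have "\<dots> = (\<Sum>\<mu> | c \<mu> \<noteq> 0. c \<mu> * (\<Prod>k\<in>#\<mu>. of_nat (N choose k)))"
      using specialize_elem_sym_part c(2) by (intro sum.cong) auto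
    also have "\<dots> = poly q (of_nat N)" by (simp add: q_def poly_sum prod)
    finally show ?thesis .
  qed
  \<comment> \<open>Agreement at infinitely many points makes the two polynomials equal.\<close>
  then have "range of_nat \<subseteq> {x. poly (p - q) x = 0}" by auto
  moreover have "infinite (range (of_nat :: nat \<Rightarrow> rat))"
    by (simp add: range_inj_infinite inj_of_nat)
  ultimately have "infinite {x. poly (p - q) x = 0}" using finite_subset by blast
  then have "p - q = 0" using poly_roots_finite[of "p - q"] by argo
  then have "p = q" by simp
  \<comment> \<open>With the one-part term absent, every term of \<open>q\<close> comes from at
    least two parts.\<close>
  have "coeff (\<Prod>k\<in>#\<mu>. binomial_poly k) 1 = 0" if \<mu>: "c \<mu> \<noteq> 0" for \<mu>
  proof (rule coeff_prod_binomial_poly)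
    show "is_partition \<mu>" using c(1) \<mu> by (simp add: is_e_expansion_iff)
    have "n \<ge> 1" using V \<open>pverts G \<noteq> {}\<close> card_gt_0_iff[of "pverts G"] by linarith
    moreover have "\<mu> \<noteq> {#n#}" using 0 \<mu> by auto
    ultimately show "size \<mu> \<ge> 2" using two_le_size_if_ne_single c(2)[OF \<mu>] by blast
  qed
  then have "coeff p 1 = 0" by (simp add: \<open>p = q\<close> q_def coeff_sum)
  then show False using p(2) by simp
qed

section \<open>The chromatic symmetric function of the complete graph\<close>

lemma chromatic_sym_complete:
  assumes V: "finite (pverts K)" "card (pverts K) = n"
    and K: "parcs K = {(u, v). (u, v) \<in> pverts K \<times> pverts K \<and> u \<noteq> v}"
  shows "chromatic_sym K = fact n *\<^sub>s elem_sym n"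
proof (rule pseries_eqI)
  fix M
  let ?V = "pverts K"
  let ?K = "{\<kappa> \<in> proper_colorings K. image_mset \<kappa> (mset_set ?V) = M}"
  have pc: "proper_colorings K = {\<kappa> \<in> ?V \<rightarrow>\<^sub>E {1..}. inj_on \<kappa> ?V}"
    using K by (auto simp: proper_colorings_def inj_on_def)
  have im: "image_mset \<kappa> (mset_set ?V) = mset_set (\<kappa> ` ?V)" if "\<kappa> \<in> proper_colorings K" for \<kappa>
    using that by (simp add: pc image_mset_mset_set)
  show "mcoeff (chromatic_sym K) M = mcoeff (fact n *\<^sub>s elem_sym n) M"
  proof (cases "\<exists>S. finite S \<and> S \<subseteq> {1..} \<and> card S = n \<and> M = mset_set S")
    case True
    then obtain S where S: "finite S" "S \<subseteq> {1..}" "card S = n" "M = mset_set S" by blast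
    \<comment> \<open>Proper colorings are the injective ones, and an injection into a set of the
      same size is onto; so the colorings with color set \<open>S\<close> are counted by
      \<open>fact n\<close>.\<close>
    have "?K = {\<kappa> \<in> ?V \<rightarrow>\<^sub>E S. inj_on \<kappa> ?V}"
    proof (intro set_eqI iffI)
      fix \<kappa> assume \<kappa>: "\<kappa> \<in> ?K"
      then have "mset_set (\<kappa> ` ?V) = mset_set S" using im S(4) by auto
      then have "\<kappa> ` ?V = S" using V S(1) by (simp add: mset_set_eq_iff)
      then show "\<kappa> \<in> {\<kappa> \<in> ?V \<rightarrow>\<^sub>E S. inj_on \<kappa> ?V}" using \<kappa> by (auto simp: pc)
    next
      fix \<kappa> assume \<kappa>: "\<kappa> \<in> {\<kappa> \<in> ?V \<rightarrow>\<^sub>E S. inj_on \<kappa> ?V}"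
      then have "\<kappa> ` ?V = S" using V S by (intro card_subset_eq) (auto simp: card_image)
      moreover have "\<kappa> \<in> proper_colorings K" using \<kappa> S(2) by (auto simp: pc)
      ultimately show "\<kappa> \<in> ?K" using im S(4) by auto
    qed
    then have "card ?K = (\<Prod>i=0..<n. n - i)"
      using card_inj_on_subset_funcset[OF V(1) S(1) order_refl] V(2) S(3) by simp
    then have "card ?K = fact n" using fact_prod_rev[of n, where 'a = nat] by simp
    then show ?thesis using True by (simp add: mcoeff_chromatic_sym elem_sym_def)
  next
    case False
    have "?K = {}"
    proof (rule ccontr)
      assume "?K \<noteq> {}"
      then obtain \<kappa> where \<kappa>: "\<kappa> \<in> proper_colorings K" "M = mset_set (\<kappa> ` ?V)" using im by auto
      then have "finite (\<kappa> ` ?V) \<and> \<kappa> ` ?V \<subseteq> {1..} \<and> card (\<kappa> ` ?V) = n"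
        using V by (auto simp: pc card_image)
      then show False using False \<kappa>(2) by blast
    qed
    then show ?thesis using False by (simp add: mcoeff_chromatic_sym elem_sym_def del: Collect_empty_eq)
  qed
qed

section \<open>Minimality of the complete graph\<close>

lemma connected_rel_if_connected:
  assumes "Digraph_Component.connected (with_proj G)"
  shows "connected_rel (pverts G) (parcs G)"
proof -
  let ?S = "mk_symmetric (with_proj G)"
  have S: "parcs ?S = parcs G \<union> (parcs G)\<inverse>" by (force simp: parcs_mk_symmetric)
  have "(x, y) \<in> (parcs ?S)\<^sup>*" if "x \<rightarrow>\<^sup>*\<^bsub>with_proj ?S\<^esub> y" for x y
    using that unfolding reachable_def by (auto dest: rtrancl_on_mono rtrancl_on_rtranclI)
  then show ?thesis
    using assms unfolding connected_def strongly_connected_def connected_rel_def S[symmetric] by auto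
qed

lemma connected_graphs_complete:
  assumes "complete_digraph n (with_proj K)" "n \<ge> 1"
  shows "K \<in> connected_graphs n"
proof -
  let ?S = "mk_symmetric (with_proj K)"
  have K: "card (pverts K) = n" "parcs K = {(u, v). (u, v) \<in> pverts K \<times> pverts K \<and> u \<noteq> v}"
    using assms(1) unfolding complete_digraph_pair_def by auto
  \<comment> \<open>Connectedness includes a nonempty vertex set, which \<open>n \<ge> 1\<close>
    provides.\<close>
  have "pverts K \<noteq> {}" using K(1) assms(2) by auto
  moreover have "x \<rightarrow>\<^sup>*\<^bsub>with_proj ?S\<^esub> y" if "x \<in> pverts K" "y \<in> pverts K" for x y
  proof (cases "x = y")
    case False
    then have "(x, y) \<in> parcs ?S" using that K(2) by (force simp: parcs_mk_symmetric)
    then show ?thesis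
      using that rtrancl_on_into_rtrancl_on[OF rtrancl_on_refl, of x "pverts K" y] by (simp add: reachable_def)
  qed (use that in \<open>auto simp: reachable_def\<close>)
  ultimately show ?thesis
    using K(1) pair_graphI_complete[OF assms(1)]
    by (auto simp: connected_graphs_def connected_def strongly_connected_def)
qed

lemma connected_graphs_chromatic_e_expansion:
  assumes "H \<in> connected_graphs n"
  obtains c where "is_e_expansion (chromatic_sym H) c" "\<And>\<mu>. c \<mu> \<noteq> 0 \<Longrightarrow> \<Sum>\<^sub># \<mu> = n" "c {#n#} \<noteq> 0"
proof -
  interpret pair_graph H using assms by (simp add: connected_graphs_def)
  have "(a, a) \<notin> parcs H" for a using no_loops[of "(a, a)"] by auto
  then have H: "finite (pverts H)" "card (pverts H) = n" "parcs H \<subseteq> pverts H \<times> pverts H" "irrefl (parcs H)"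
    using assms by (auto simp: connected_graphs_def irrefl_def dest: wellformed')
  obtain c where c: "is_e_expansion (chromatic_sym H) c" "\<And>\<mu>. c \<mu> \<noteq> 0 \<Longrightarrow> \<Sum>\<^sub># \<mu> = n"
    using exists_e_expansion[OF symmetric_chromatic_sym homogeneous_chromatic_sym] H by metis
  have "connected_rel (pverts H) (parcs H)"
    using assms by (simp add: connected_graphs_def connected_rel_if_connected)
  from that[OF c] chromatic_e_coeff_ne_0[OF H(1-4) this c] show thesis by blast
qed

text \<open>Evaluation at the leading monomial of \<open>\<mu>\<close>: \<open>e_n\<close> does not
  reach it, so all terms are nonpositive, and a nonzero \<open>c \<mu>\<close> would make the
  coefficient of \<open>F\<close> negative.\<close>

lemma e_coeff_eq_0_if_nonpos:
  assumes F: "\<And>M. mcoeff F M \<ge> 0"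
    and c: "is_e_expansion F c" "\<And>\<mu>. \<mu> \<noteq> {#n#} \<Longrightarrow> c \<mu> \<le> 0"
    and \<mu>: "\<mu> \<noteq> {#n#}" "\<Sum>\<^sub># \<mu> = n" "n \<ge> 1"
  shows "c \<mu> = 0"
proof (rule ccontr)
  assume ne: "c \<mu> \<noteq> 0"
  then have pos: "0 \<notin># \<mu>" using c(1) by (auto simp: is_e_expansion_iff is_partition_def)
  let ?L = "lead_monom \<mu>"
  \<comment> \<open>The variable \<open>x_1\<close> occurs once for every positive part, hence at
    least twice, so the leading monomial is not squarefree.\<close>
  have "{#k \<in># \<mu>. 1 \<le> k#} = \<mu>" using pos by (auto simp: filter_mset_eq_conv Suc_le_eq intro: gr0I)
  then have "count ?L 1 = size \<mu>" by (simp add: count_lead_monom)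
  then have L: "count ?L 1 \<ge> 2" using two_le_size_if_ne_single[OF \<mu>] by linarith
  have n: "mcoeff (elem_sym_part {#n#}) ?L = 0"
  proof (rule ccontr)
    assume "mcoeff (elem_sym_part {#n#}) ?L \<noteq> 0"
    then obtain S :: "nat set" where "?L = mset_set S"
      by (auto simp: elem_sym_part_def elim: mcoeff_elem_sym_ne0D)
    then show False using L by (simp add: count_mset_set' split: if_splits)
  qed
  let ?f = "\<lambda>\<nu>. c \<nu> * mcoeff (elem_sym_part \<nu>) ?L"
  have le: "?f \<nu> \<le> 0" for \<nu>
    using c(2)[of \<nu>] n mcoeff_elem_sym_part_nonneg[of \<nu> ?L] by (cases "\<nu> = {#n#}") (auto intro: mult_nonpos_nonneg)
  have "finite {\<nu>. c \<nu> \<noteq> 0}" using c(1) by (simp add: is_e_expansion_iff)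
  then have "mcoeff F ?L = ?f \<mu> + (\<Sum>\<nu>\<in>{\<nu>. c \<nu> \<noteq> 0} - {\<mu>}. ?f \<nu>)"
    using c(1) ne by (simp add: is_e_expansion_iff sum.remove)
  also have "\<dots> \<le> ?f \<mu>" using le by (simp add: sum_nonpos)
  also have "?f \<mu> < 0"
    using mcoeff_lead_monom_pos[of \<mu>] c(2)[OF \<mu>(1)] ne by (simp add: mult_neg_pos)
  finally show False using F[of ?L] by simp
qed

theorem corollary3p5:
  fixes n :: nat and K :: "nat pair_pre_digraph"
  assumes "n \<ge> 1"
    and "complete_digraph n (with_proj K)"
  shows "minimal_element (E_poset n) (e_geq n) (csf_rel n `` {K})"
  unfolding minimal_element_def
proof (intro conjI ballI impI)
  have K: "K \<in> connected_graphs n" using connected_graphs_complete assms by blast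
  then show "csf_rel n `` {K} \<in> E_poset n" by (simp add: E_poset_def quotientI)
  fix y assume y: "y \<in> E_poset n"
    and comp: "e_geq n (csf_rel n `` {K}) y \<or> e_geq n y (csf_rel n `` {K})"
  obtain H where H: "H \<in> connected_graphs n" "y = csf_rel n `` {H}"
    using y by (auto simp: E_poset_def elim!: quotientE)
  \<comment> \<open>\<open>X_e\<close> depends on its arguments only through their chromatic
    symmetric functions, so the chosen representatives decide the order.\<close>
  have geq: "e_geq n (csf_rel n `` {A}) (csf_rel n `` {B}) \<longleftrightarrow> e_positive (X_e n A B)"
    if "A \<in> connected_graphs n" "B \<in> connected_graphs n" for A B
    using that by (auto simp: e_geq_def csf_rel_def X_e_def)
  \<comment> \<open>If \<open>y\<close> is already above the class of \<open>K\<close>, nothing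
    remains; the opposite comparison has to be reversed.\<close>
  have "e_positive (X_e n H K)" if pos: "e_positive (X_e n K H)"
  proof -
    obtain c where c: "is_e_expansion (chromatic_sym H) c"
      "\<And>\<mu>. c \<mu> \<noteq> 0 \<Longrightarrow> \<Sum>\<^sub># \<mu> = n" "c {#n#} \<noteq> 0"
      using connected_graphs_chromatic_e_expansion[OF H(1)] by blast
    define d :: "nat multiset \<Rightarrow> rat" where "d = (\<lambda>\<mu>. if \<mu> = {#n#} then fact n else 0)"
    have "chromatic_sym K = fact n *\<^sub>s elem_sym n"
      using assms(2) by (intro chromatic_sym_complete) (auto simp: complete_digraph_pair_def)
    moreover have "{\<mu>. d \<mu> \<noteq> 0} = {{#n#}}" by (auto simp: d_def)
    ultimately have d: "is_e_expansion (chromatic_sym K) d"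
      using assms(1) by (simp add: is_e_expansion_iff elem_sym_part_def)
        (auto simp: d_def is_partition_def)
    \<comment> \<open>Away from \<open>{#n#}\<close> the coefficient \<open>d \<mu>\<close> is 0, so
      this says that \<open>c \<mu>\<close> and \<open>c {#n#}\<close> do not have the same strict
      sign.\<close>
    have KH: "0 \<le> d \<mu> - d {#n#} / c {#n#} * c \<mu>" if "is_partition \<mu>" for \<mu>
      using pos that e_coeff_eqI[OF e_expansion_lincomb[OF d c(1)]]
      by (simp add: e_positive_def X_e_def e_coeff_eqI[OF c(1)] e_coeff_eqI[OF d])
    have fact: "\<not> (fact n :: rat) \<le> 0" by (simp add: not_le)
    \<comment> \<open>This is the coefficient of \<open>X_e n H K\<close> away from
      \<open>{#n#}\<close>. A positive \<open>c {#n#}\<close> makes all such coefficients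
      nonpositive and hence 0; a negative one makes them nonnegative at once.\<close>
    have "c \<mu> \<ge> 0" if \<mu>: "\<mu> \<noteq> {#n#}" for \<mu>
    proof (cases "c {#n#} > 0")
      case True
      have "c \<nu> \<le> 0" if "\<nu> \<noteq> {#n#}" for \<nu>
      proof (cases "c \<nu> = 0")
        case False
        then have "is_partition \<nu>" using c(1) by (simp add: is_e_expansion_iff)
        then show ?thesis using KH[of \<nu>] that True by (simp add: d_def fact mult_le_0_iff divide_le_0_iff)
      qed simp
      then show ?thesis
        using e_coeff_eq_0_if_nonpos[OF _ c(1), of n \<mu>] \<mu> c(2)[of \<mu>] assms(1)
        by (force simp: mcoeff_chromatic_sym)
    next
      case False
      then have "c {#n#} < 0" using c(3) by simp
      moreover have "is_partition \<mu>" if "c \<mu> \<noteq> 0" using that c(1) by (simp add: is_e_expansion_iff)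
      ultimately show ?thesis using KH[of \<mu>] \<mu>
        by (cases "c \<mu> = 0") (auto simp: d_def fact zero_le_mult_iff mult_le_0_iff divide_le_0_iff)
    qed
    \<comment> \<open>At \<open>{#n#}\<close> the two summands cancel; elsewhere
      \<open>d \<mu>\<close> is 0.\<close>
    then have "0 \<le> c \<mu> - c {#n#} / d {#n#} * d \<mu>" for \<mu> by (simp add: d_def)
    then show ?thesis
      using e_coeff_eqI[OF e_expansion_lincomb[OF c(1) d]]
      by (simp add: e_positive_def X_e_def e_coeff_eqI[OF c(1)] e_coeff_eqI[OF d])
  qed
  then show "e_geq n y (csf_rel n `` {K})" using comp geq K H by auto
qed

end
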